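(* Let $T>0$, let $\rho:(0,T)\times\mathbb{R}\to[0,1]$ be a density function, let $\kappa\in(0,1)$, and let $\Psi:\mathbb{R}\to\mathbb{R}$ be an increasing, odd, Lipschitz continuous function with $\|\Psi\|_{L^\infty(\mathbb{R})}\le 1$. Define the perceived density $$\hat\rho(t,x) := \rho(t,x) + \kappa\, D(\rho(t,x))\,\Psi(\partial_x\rho(t,x)),\qquad D(r):=r(1-r)\ \text{ for } r\in[0,1].$$ Then $\hat\rho(t,x)\in[0,1]$ at every point $(t,x)\in(0,T)\times\mathbb{R}$ at which the spatial derivative $\partial_x\rho(t,x)$ exists.
   Context: The function $\rho(t,x)$ is the normalized traffic density (maximal density $1$) at time $t$ and position $x$, $\partial_x\rho$ is its partial derivative in $x$, $\kappa$ is the diffusion coefficient, $D$ is the nonlinear (degenerate) diffusion coefficient, and $\Psi$ is the saturation function, for example $\Psi(s)=\tanh(s)$. *)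

theory Defs
  imports "HOL-Analysis.Analysis" "HOL-Probability.Essential_Supremum"
begin

definition diffusion :: "real \<Rightarrow> real" where
  "diffusion r = r * (1 - r)"

text \<open>The partial derivative in space is \<open>deriv (\<rho> t) x\<close>, an unspecified
  number wherever \<open>\<rho> t\<close> is not differentiable at \<open>x\<close>.\<close>

definition perceived_density ::
  "real \<Rightarrow> (real \<Rightarrow> real) \<Rightarrow> (real \<Rightarrow> real \<Rightarrow> real) \<Rightarrow> real \<Rightarrow> real \<Rightarrow> real" where
  "perceived_density \<kappa> \<Psi> \<rho> t x =
     \<rho> t x + \<kappa> * diffusion (\<rho> t x) * \<Psi> (deriv (\<rho> t) x)"

definition Linf_norm :: "(real \<Rightarrow> real) \<Rightarrow> ereal" where
  "Linf_norm f = esssup lborel (\<lambda>x. ereal \<bar>f x\<bar>)"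

end

theory Submission
  imports Defs
begin

text \<open>With r the density and a the product of \<kappa> and the saturated slope, the perceived
  density is r + a r (1 - r). The diffusion vanishes at r = 0 and r = 1, so if |a| \<le> 1 the
  perturbation cannot leave the unit interval (\<open>add_mult_diffusion_in_unit_interval\<close>).
  That |a| \<le> 1 needs a bound on \<Psi> at a single point, which
  \<open>abs_le_of_Linf_norm_le\<close> extracts from the essential bound by continuity.\<close>

text \<open>By continuity the set where |f| \<le> c is closed; its complement is open and null,
  hence empty.\<close>

lemma abs_le_of_Linf_norm_le:
  fixes f :: "real \<Rightarrow> real"
  assumes cont: "continuous_on UNIV f" and bound: "Linf_norm f \<le> ereal c"
  shows "\<bar>f x\<bar> \<le> c"
proof -
  have "AE x in lborel. ereal \<bar>f x\<bar> \<le> Linf_norm f"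
    unfolding Linf_norm_def by (rule esssup_AE)
  then have "AE x in lborel. x \<in> {x. \<bar>f x\<bar> \<le> c}"
    using bound by (force elim: eventually_mono dest: order_trans)
  \<comment> \<open>The closed-set criterion used below speaks of \<open>lebesgue\<close>, the
    completion of \<open>lborel\<close>.\<close>
  then have "AE x in lebesgue. x \<in> {x. \<bar>f x\<bar> \<le> c}"
    by (rule AE_completion)
  moreover have "closed {x. \<bar>f x\<bar> \<le> c}"
    using cont by (intro closed_Collect_le continuous_intros)
  ultimately have "x \<in> {x. \<bar>f x\<bar> \<le> c}"
    by (intro mem_closed_if_AE_lebesgue)
  then show ?thesis by simp
qed

text \<open>Both the value and its distance to 1 factor into nonnegative terms: r (1 + a (1 - r))
  and (1 - r) (1 - a r).\<close>

lemma add_mult_diffusion_in_unit_interval: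
  assumes "r \<in> {0..1}" and "\<bar>a\<bar> \<le> 1"
  shows "r + a * diffusion r \<in> {0..1}"
proof -
  have "0 \<le> r * (1 + a * (1 - r))"
    \<comment> \<open>The instance gives - a (1 - r) \<le> 1, the sign of the second factor.\<close>
    using assms mult_mono[of "- a" 1 "1 - r" 1] by (intro mult_nonneg_nonneg) (auto simp: abs_le_iff)
  moreover have "0 \<le> (1 - r) * (1 - a * r)"
    using assms mult_mono[of a 1 r 1] by (intro mult_nonneg_nonneg) (auto simp: abs_le_iff)
  ultimately show ?thesis
    by (simp add: diffusion_def algebra_simps)
qed

theorem theorem2p1:
  fixes T \<kappa> :: real
    and \<rho> :: "real \<Rightarrow> real \<Rightarrow> real"
    and \<Psi> :: "real \<Rightarrow> real"
  assumes "T > 0"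
    and "\<And>t x. t \<in> {0<..<T} \<Longrightarrow> \<rho> t x \<in> {0..1}"
    and "\<kappa> \<in> {0<..<1}"
    and "mono \<Psi>"
    and "\<And>s. \<Psi> (- s) = - \<Psi> s"
    and "\<exists>L. L-lipschitz_on UNIV \<Psi>"
    and "Linf_norm \<Psi> \<le> 1"
  shows "\<forall>t\<in>{0<..<T}. \<forall>x. \<rho> t differentiable (at x) \<longrightarrow>
    perceived_density \<kappa> \<Psi> \<rho> t x \<in> {0..1}"
proof (intro ballI allI impI)
  fix t x assume "t \<in> {0<..<T}"
  have "\<bar>\<Psi> (deriv (\<rho> t) x)\<bar> \<le> 1"
    using assms(6,7) by (intro abs_le_of_Linf_norm_le)
      (auto intro: lipschitz_on_continuous_on simp: one_ereal_def)
  then have "\<bar>\<kappa> * \<Psi> (deriv (\<rho> t) x)\<bar> \<le> 1"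
    using assms(3) by (simp add: abs_mult mult_le_one)
  \<comment> \<open>Here \<open>a\<close> is \<open>\<kappa> * \<Psi> (deriv (\<rho> t) x)\<close>;
    \<open>mult_ac\<close> moves the diffusion factor into place.\<close>
  from add_mult_diffusion_in_unit_interval[OF assms(2) this] \<open>t \<in> {0<..<T}\<close>
  show "perceived_density \<kappa> \<Psi> \<rho> t x \<in> {0..1}"
    by (simp add: perceived_density_def mult_ac)
qed

end
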